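(* Let $(x_0, x_1)$ and $(y_0, y_1)$ be pairs of floating-point numbers, all in one of the formats binary16, bfloat16, binary32, binary64, or binary128, of precision $p$, and let $u := 2^{-p}$. Suppose $x_0 = \mathrm{RNE}(x_0 + x_1)$ and $y_0 = \mathrm{RNE}(y_0 + y_1)$. Let $(z_0,z_1)$ be the output of the following algorithm ($\mathsf{madd}$): $$(a,b) := \mathrm{TwoSum}(x_0,y_0),\quad (c,d) := \mathrm{TwoSum}(x_1,y_1),\quad (a',c') := \mathrm{TwoSum}(a,c),$$ $$b' := b\oplus d,\quad b'' := b'\oplus c',\quad (z_0,z_1) := \mathrm{TwoSum}(a',b'').$$ Then $(z_0, z_1)$ approximates the exact sum $x_0+x_1+y_0+y_1$ with relative error bounded above by $(1+2u)\,2^{-(2p-1)}$; that is, whenever $x_0+x_1+y_0+y_1 \neq 0$, $$\frac{|(z_0+z_1)-(x_0+x_1+y_0+y_1)|}{|x_0+x_1+y_0+y_1|} \le (1+2u)\,2^{-(2p-1)}.$$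
   Context: Floating-point numbers are in base 2 with precision $p$ and exponent range $\{e_{\min},\dots,e_{\max}\}$. The formats are: binary16 ($p=11$, exponents $-14,\dots,15$), bfloat16 ($p=8$, $-126,\dots,127$), binary32 ($p=24$, $-126,\dots,127$), binary64 ($p=53$, $-1022,\dots,1023$), binary128 ($p=113$, $-16382,\dots,16383$). A floating-point number is either zero (positive and negative zero are identified) or normalized, i.e. of the form $(-1)^s (1.m_1m_2\dots m_{p-1})_2 \times 2^e$ with $s \in\{0,1\}$, bits $m_i\in\{0,1\}$ and $e_{\min}\le e\le e_{\max}$. Subnormal numbers, infinities and NaN are ignored: all inputs, intermediate values and outputs are assumed to be normalized or zero (in particular no overflow occurs). $\mathrm{RNE}(r)$ denotes the real number $r$ rounded to the nearest floating-point number, ties to even. $x\oplus y := \mathrm{RNE}(x+y)$, where $+$ is exact addition. $\mathrm{TwoSum}(x,y) := (s,e)$ with $s = x\oplus y$ and $e = (x+y)-(x\oplus y)$ exactly (this error is a floating-point number). *)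

theory Defs
  imports Complex_Main
begin

datatype fp_format = Binary16 | BFloat16 | Binary32 | Binary64 | Binary128

primrec precision :: "fp_format \<Rightarrow> nat" where
  "precision Binary16 = 11"
| "precision BFloat16 = 8"
| "precision Binary32 = 24"
| "precision Binary64 = 53"
| "precision Binary128 = 113"

primrec e_min :: "fp_format \<Rightarrow> int" where
  "e_min Binary16 = -14"
| "e_min BFloat16 = -126"
| "e_min Binary32 = -126"
| "e_min Binary64 = -1022"
| "e_min Binary128 = -16382"

primrec e_max :: "fp_format \<Rightarrow> int" where
  "e_max Binary16 = 15"
| "e_max BFloat16 = 127"
| "e_max Binary32 = 127"
| "e_max Binary64 = 1023"
| "e_max Binary128 = 16383"

(* (-1)^s * (1.m_1 m_2 ... m_(p-1))_2 * 2^e; only the bits m 1, ..., m (p - 1) matter. *)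
definition fp_value :: "nat \<Rightarrow> bool \<Rightarrow> (nat \<Rightarrow> bool) \<Rightarrow> int \<Rightarrow> real" where
  "fp_value p s m e =
     (-1) ^ of_bool s * (1 + (\<Sum>i = 1..p - 1. of_bool (m i) / 2 ^ i)) * 2 powi e"

definition fp_numbers :: "nat \<Rightarrow> int set \<Rightarrow> real set" where
  "fp_numbers p E = {0} \<union> {fp_value p s m e | s m e. e \<in> E}"

definition floats :: "fp_format \<Rightarrow> real set" where
  "floats fmt = fp_numbers (precision fmt) {e_min fmt..e_max fmt}"

definition even_significand :: "nat \<Rightarrow> real \<Rightarrow> bool" where
  "even_significand p x \<longleftrightarrow> x = 0 \<or> (\<exists>s m e. x = fp_value p s m e \<and> \<not> m (p - 1))"

definition nearest_in :: "real set \<Rightarrow> real \<Rightarrow> real \<Rightarrow> bool" where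
  "nearest_in F r f \<longleftrightarrow> f \<in> F \<and> (\<forall>g\<in>F. \<bar>r - f\<bar> \<le> \<bar>r - g\<bar>)"

definition nearest_even_in :: "nat \<Rightarrow> real set \<Rightarrow> real \<Rightarrow> real \<Rightarrow> bool" where
  "nearest_even_in p F r f \<longleftrightarrow>
     nearest_in F r f \<and> ((\<exists>g. g \<noteq> f \<and> nearest_in F r g) \<longrightarrow> even_significand p f)"

(* As in IEEE 754, rounding is performed as if the exponent range were unbounded; overflow or
   underflow means that the result lies outside floats fmt. If the result does lie in floats fmt,
   it is also the nearest element of floats fmt, ties to even (nearest_even_in_floats below).
   Rounding into floats fmt itself would instead saturate on overflow, and would be ambiguous
   at the midpoint between 0 and the least positive normalized number. *)
definition RNE :: "fp_format \<Rightarrow> real \<Rightarrow> real" where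
  "RNE fmt r = (THE f. nearest_even_in (precision fmt) (fp_numbers (precision fmt) UNIV) r f)"

lemma floats_subset: "floats fmt \<subseteq> fp_numbers (precision fmt) UNIV"
  by (auto simp: floats_def fp_numbers_def)

lemma nearest_even_in_floats:
  assumes "nearest_even_in (precision fmt) (fp_numbers (precision fmt) UNIV) r f"
    and "f \<in> floats fmt"
  shows "nearest_even_in (precision fmt) (floats fmt) r f"
proof -
  let ?F = "fp_numbers (precision fmt) UNIV"
  have near: "nearest_in ?F r f"
    using assms(1) by (simp add: nearest_even_in_def)
  have "nearest_in ?F r g" if g: "nearest_in (floats fmt) r g" for g
  proof -
    have "g \<in> ?F" "\<bar>r - g\<bar> \<le> \<bar>r - f\<bar>"
      using g assms(2) floats_subset[of fmt] by (auto simp: nearest_in_def)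
    then show ?thesis
      using near by (fastforce simp: nearest_in_def)
  qed
  moreover have "nearest_in (floats fmt) r f"
    using near assms(2) floats_subset[of fmt] by (auto simp: nearest_in_def)
  ultimately show ?thesis
    using assms(1) by (auto simp: nearest_even_in_def)
qed

definition fp_add :: "fp_format \<Rightarrow> real \<Rightarrow> real \<Rightarrow> real" where
  "fp_add fmt x y = RNE fmt (x + y)"

definition TwoSum :: "fp_format \<Rightarrow> real \<Rightarrow> real \<Rightarrow> real \<times> real" where
  "TwoSum fmt x y = (fp_add fmt x y, (x + y) - fp_add fmt x y)"

end

theory Submission
  imports Defs
begin

text \<open>
  Rounding to nearest even commutes with negation and with multiplication by powers of two, and the
  algorithm is symmetric in its two arguments, so one may assume \<open>1 \<le> x0 < 2\<close> and
  \<open>\<bar>y0\<bar> \<le> x0\<close>. Put \<open>h = x0 + y0\<close>, \<open>l = x1 + y1\<close> and \<open>S = h + l\<close>.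

  If \<open>h\<close> is representable, then \<open>b = 0\<close> and only the rounding of \<open>d + c'\<close> counts. Either \<open>a + c\<close> is
  exact (Sterbenz), and the error vanishes, or \<open>\<bar>c\<bar> \<le> \<bar>a + c\<bar>\<close>, so that \<open>d\<close> and \<open>c'\<close> are at
  most \<open>u * \<bar>a + c\<bar>\<close>.

  Otherwise there is no severe cancellation. For \<open>a \<ge> 2\<close> the error is at most \<open>3 u\<^sup>2\<close>, while \<open>S\<close> is
  nearly 2. For \<open>1 \<le> h\<close> and \<open>a < 2\<close> it is at most \<open>2 u\<^sup>2\<close>, because \<open>b + d\<close>, which is at most
  \<open>u + u\<^sup>2\<close> in absolute value, is rounded to at most \<open>u\<close>: this uses ties-to-even. For \<open>h < 1\<close> one has
  \<open>\<bar>y0\<bar> < 1 / 2\<close>, since otherwise \<open>h\<close> would be a multiple of \<open>u\<close> and representable; then the error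
  is at most \<open>u\<^sup>2\<close> and \<open>S \<ge> 1 / 2 - u / 4\<close>, except for \<open>a = 1\<close>, where it is at most \<open>3 u\<^sup>2 / 2\<close> and
  \<open>S\<close> is nearly 1.
\<close>

section \<open>Floating-point numbers as scaled integers\<close>

lemma ex_power_int_bounds:
  fixes x :: real
  assumes "x > 0"
  obtains k :: int where "2 powi k \<le> x" "x < 2 powi (k + 1)"
proof
  let ?k = "\<lfloor>log 2 x\<rfloor>"
  have "2 powr of_int ?k \<le> 2 powr log 2 x" "2 powr log 2 x < 2 powr of_int (?k + 1)"
    by (intro powr_mono powr_less_mono; linarith)+
  moreover have "2 powr log 2 x = x"
    using assms by simp
  ultimately show "2 powi ?k \<le> x" "x < 2 powi (?k + 1)"
    by (metis powr_real_of_int' zero_le_numeral zero_neq_numeral)+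
qed

text \<open>Appending a bit turns the numerator \<open>n\<close> into \<open>2 * n\<close> plus that
  bit, so the parity of the numerator is the last bit.\<close>

lemma sum_bits:
  "\<exists>n<2 ^ q. (\<Sum>i = 1..q. of_bool (m i) / 2 ^ i) = (real n / 2 ^ q) \<and> (q > 0 \<longrightarrow> (odd n \<longleftrightarrow> m q))"
proof (induction q)
  case (Suc q)
  then obtain n where n: "n < 2 ^ q" "(\<Sum>i = 1..q. of_bool (m i) / 2 ^ i) = real n / 2 ^ q"
    by blast
  show ?case
    using n by (intro exI[of _ "2 * n + of_bool (m (Suc q))"]) (auto simp: field_simps)
qed simp

lemma ex_bits:
  "n < 2 ^ q \<Longrightarrow> \<exists>m. (\<Sum>i = 1..q. of_bool (m i) / 2 ^ i) = (real n / 2 ^ q) \<and> (q > 0 \<longrightarrow> (odd n \<longleftrightarrow> m q))"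
proof (induction q arbitrary: n)
  case (Suc q)
  then have "n div 2 < 2 ^ q"
    by auto
  from Suc.IH[OF this] obtain m where
    m: "(\<Sum>i = 1..q. of_bool (m i) / 2 ^ i) = real (n div 2) / 2 ^ q"
    by blast
  have n: "real n = 2 * real (n div 2) + of_bool (odd n)"
    by (cases "even n") (auto elim!: evenE oddE)
  have "(\<Sum>i = 1..q. of_bool ((m(Suc q := odd n)) i) / 2 ^ i) = real (n div 2) / 2 ^ q"
    unfolding m[symmetric] by (intro sum.cong) auto
  then show ?case
    using n by (intro exI[of _ "m(Suc q := odd n)"]) (simp add: field_simps)
qed simp

lemma fp_value_eq_int:
  assumes "p \<ge> 2"
  shows "\<exists>n::int. 2 ^ (p - 1) \<le> \<bar>n\<bar> \<and> \<bar>n\<bar> < 2 ^ p \<and> (odd n \<longleftrightarrow> m (p - 1)) \<and>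
    fp_value p s m e = of_int n * 2 powi (e + 1 - int p)"
proof -
  obtain q where p: "p = Suc q" and q: "q > 0"
    using assms by (cases p) auto
  obtain n where n: "n < 2 ^ q" "(\<Sum>i = 1..q. of_bool (m i) / 2 ^ i) = real n / 2 ^ q"
    "odd n \<longleftrightarrow> m q"
    using sum_bits[of q m] q by blast
  have n': "int n < 2 ^ q"
    using n(1) by (metis of_nat_less_iff of_nat_numeral of_nat_power)
  have *: "2 powi (e + 1 - int p) = 2 powi e / (2 ^ q :: real)"
    unfolding p by (simp add: power_int_diff)
  have "fp_value p s m e = of_int ((-1) ^ of_bool s * (2 ^ q + int n)) * 2 powi (e + 1 - int p)"
    unfolding fp_value_def * using n(2) by (simp add: p field_simps)
  moreover have "\<bar>(-1) ^ of_bool s * (2 ^ q + int n)\<bar> = 2 ^ q + int n"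
    by (simp only: abs_mult power_abs) simp
  moreover have "odd ((-1) ^ of_bool s * (2 ^ q + int n)) \<longleftrightarrow> m q"
    using n(3) q by auto
  ultimately show ?thesis
    using n' by (intro exI[of _ "(-1) ^ of_bool s * (2 ^ q + int n)"]) (simp add: p)
qed

lemma ex_fp_value:
  fixes n :: int
  assumes "p \<ge> 2" "2 ^ (p - 1) \<le> \<bar>n\<bar>" "\<bar>n\<bar> < 2 ^ p"
  shows "\<exists>s m e'. of_int n * 2 powi e = fp_value p s m e' \<and> (odd n \<longleftrightarrow> m (p - 1))"
proof -
  obtain q where p: "p = Suc q" and q: "q > 0"
    using assms by (cases p) auto
  define k where "k = nat (\<bar>n\<bar> - 2 ^ q)"
  have k: "int k = \<bar>n\<bar> - 2 ^ q"
    using assms by (simp add: k_def p)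
  then have "int k < 2 ^ q"
    using assms by (simp add: p)
  then have "k < 2 ^ q"
    by (metis of_nat_less_iff of_nat_numeral of_nat_power)
  from ex_bits[OF this] obtain m where
    m: "(\<Sum>i = 1..q. of_bool (m i) / 2 ^ i) = real k / 2 ^ q" "odd k \<longleftrightarrow> m q"
    using q by blast
  have n: "n = (-1) ^ of_bool (n < 0) * (2 ^ q + int k)"
    using k by auto
  have "odd (int k) \<longleftrightarrow> odd n"
    unfolding k using q by auto
  moreover have "of_int n * 2 powi e = fp_value p (n < 0) m (e + int q)"
  proof -
    have "of_int n = (-1) ^ of_bool (n < 0) * (2 ^ q + real k)"
      by (subst n) simp
    then show ?thesis
      unfolding fp_value_def p using m(1) by (simp add: power_int_add field_simps)
  qed
  ultimately show ?thesis
    using m(2) by (auto simp: p)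
qed

lemma ex_int_nearest_even:
  fixes t :: real
  shows "\<exists>N::int. \<bar>of_int N - t\<bar> \<le> 1 / 2 \<and> (\<bar>of_int N - t\<bar> = 1 / 2 \<longrightarrow> even N)"
proof -
  define n where "n = \<lfloor>t\<rfloor>"
  have n: "of_int n \<le> t" "t < of_int n + 1"
    unfolding n_def by linarith+
  consider "t - of_int n < 1 / 2" | "t - of_int n > 1 / 2" | "t - of_int n = 1 / 2"
    by linarith
  then show ?thesis
  proof cases
    case 1
    then show ?thesis
      using n by (intro exI[of _ n]) auto
  next
    case 2
    then show ?thesis
      using n by (intro exI[of _ "n + 1"]) auto
  next
    case 3
    then have *: "\<bar>of_int n - t\<bar> \<le> 1 / 2" "\<bar>of_int (n + 1) - t\<bar> \<le> 1 / 2"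
      by auto
    have "even n \<or> even (n + 1)"
      by simp
    then show ?thesis
      using * by blast
  qed
qed

text \<open>The bound 3, met by all five formats, yields \<open>u \<le> 1 / 8\<close>, the slack in
  the numeric estimates.\<close>

locale fp_rounding =
  fixes p :: nat
  assumes p_ge_3: "p \<ge> 3"
begin

abbreviation "F \<equiv> fp_numbers p UNIV"

definition u :: real where "u = 2 powi (- int p)"

definition R :: "real \<Rightarrow> real" where "R r = (THE f. nearest_even_in p F r f)"

lemma F_iff:
  "x \<in> F \<longleftrightarrow> x = 0 \<or> (\<exists>(n::int) e. 2 ^ (p - 1) \<le> \<bar>n\<bar> \<and> \<bar>n\<bar> < 2 ^ p \<and> x = of_int n * 2 powi e)"
proof -
  have "p \<ge> 2"
    using p_ge_3 by simp
  then show ?thesis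
    unfolding fp_numbers_def using fp_value_eq_int[of p] ex_fp_value[of p]
    by (simp; intro iffI; elim exE conjE disjE; metis)
qed

lemma even_significand_iff:
  "even_significand p x \<longleftrightarrow>
     x = 0 \<or> (\<exists>(n::int) e. 2 ^ (p - 1) \<le> \<bar>n\<bar> \<and> \<bar>n\<bar> < 2 ^ p \<and> even n \<and> x = of_int n * 2 powi e)"
proof -
  have "p \<ge> 2"
    using p_ge_3 by simp
  then show ?thesis
    unfolding even_significand_def using fp_value_eq_int[of p] ex_fp_value[of p] by metis
qed

lemma u_eq: "u = 1 / 2 ^ p"
  by (simp add: u_def power_int_minus field_simps)

lemma u_pos: "u > 0"
  by (simp add: u_eq)

lemma u_le: "u \<le> 1 / 8"
proof -
  have "(2::real) ^ 3 \<le> 2 ^ p"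
    using p_ge_3 by (intro power_increasing) auto
  then show ?thesis
    by (simp add: u_eq field_simps)
qed

text \<open>Shifting \<open>n\<close> left until it has \<open>p\<close> binary digits normalizes
  it; \<open>\<bar>n\<bar> = 2 ^ p\<close> becomes \<open>2 ^ (p - 1)\<close> with the exponent
  raised by one. This is the usual way below to show membership in \<open>F\<close>.\<close>

lemma of_int_power_int_in_F:
  fixes n :: int
  assumes "\<bar>n\<bar> \<le> 2 ^ p"
  shows "of_int n * 2 powi e \<in> F"
proof (cases "n = 0 \<or> \<bar>n\<bar> = 2 ^ p")
  case True
  moreover have "of_int n * 2 powi e \<in> F" if "\<bar>n\<bar> = 2 ^ p"
  proof -
    obtain q where p: "p = Suc q"
      using p_ge_3 by (cases p) auto
    have "of_int n * (2::real) powi e = of_int (sgn n * 2 ^ q) * 2 powi (e + 1)"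
    proof -
      have "n = sgn n * 2 ^ p"
        using that by (metis mult_sgn_abs)
      then have "of_int n = of_int (sgn n) * (2 ^ p :: real)"
        by (metis of_int_mult of_int_numeral of_int_power)
      then show ?thesis
        by (simp add: p power_int_add)
    qed
    moreover have "\<bar>sgn n * 2 ^ q\<bar> = 2 ^ q"
      using that by (auto simp: abs_mult)
    ultimately show ?thesis
      unfolding F_iff using p by (intro disjI2 exI[of _ "sgn n * 2 ^ q"] exI[of _ "e + 1"]) simp
  qed
  ultimately show ?thesis
    by (auto simp: F_iff)
next
  case False
  then obtain k where k: "2 powi k \<le> \<bar>real_of_int n\<bar>" "\<bar>real_of_int n\<bar> < 2 powi (k + 1)"
    using ex_power_int_bounds[of "\<bar>real_of_int n\<bar>"] by (metis of_int_eq_0_iff zero_less_abs_iff)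
  have n: "\<bar>n\<bar> < 2 ^ p" "\<bar>n\<bar> \<ge> 1"
    using assms False by auto
  have n': "\<bar>real_of_int n\<bar> < 2 powi int p"
    using n(1) by (simp flip: of_int_abs)
  have "2 powi k < (2::real) powi int p"
    using k(1) n' by linarith
  then have "k < int p"
    by (smt (verit) power_int_increasing)
  moreover have "(2::real) powi 0 < 2 powi (k + 1)"
    using k(2) n(2) by (simp flip: of_int_abs)
  then have "k \<ge> 0"
    by (smt (verit) power_int_increasing)
  ultimately obtain i j where i: "k = int i" and p: "p = Suc (i + j)"
    by (metis less_imp_Suc_add of_nat_less_iff zero_le_imp_eq_int)
  have "2 ^ i \<le> \<bar>n\<bar>" "\<bar>n\<bar> < 2 ^ Suc i"
  proof -
    have "real_of_int (2 ^ i) \<le> real_of_int \<bar>n\<bar>" "real_of_int \<bar>n\<bar> < real_of_int (2 ^ Suc i)"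
      using k by (simp_all add: i power_int_add)
    then show "2 ^ i \<le> \<bar>n\<bar>" "\<bar>n\<bar> < 2 ^ Suc i"
      by linarith+
  qed
  then have "2 ^ (p - 1) \<le> \<bar>n * 2 ^ j\<bar>" "\<bar>n * 2 ^ j\<bar> < 2 ^ p"
    by (simp_all add: p power_add abs_mult)
  moreover have "of_int n * (2::real) powi e = of_int (n * 2 ^ j) * 2 powi (e - int j)"
    by (simp add: power_int_diff)
  ultimately show ?thesis
    unfolding F_iff by blast
qed

lemma power_int_in_F: "2 powi k \<in> F"
  using of_int_power_int_in_F[of 1 k] by simp

lemma uminus_in_F_iff: "- x \<in> F \<longleftrightarrow> x \<in> F"
proof -
  have "- x \<in> F" if "x \<in> F" for x
    using that unfolding F_iff
    by (metis (no_types, opaque_lifting) abs_minus_cancel minus_zero mult_minus_left of_int_minus)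
  from this[of x] this[of "-x"] show ?thesis
    by auto
qed

text \<open>The spacing of \<open>F\<close> never shrinks as magnitudes grow, so everything from
  \<open>2 powi k\<close> on lies on the grid of that binade.\<close>

lemma F_multiple:
  assumes "x \<in> F" "2 powi k \<le> \<bar>x\<bar>"
  obtains n :: int where "x = of_int n * 2 powi (k + 1 - int p)"
proof -
  have "\<bar>x\<bar> > 0"
    using assms(2) by (smt (verit) zero_less_power_int)
  then obtain n :: int and e where n: "\<bar>n\<bar> < 2 ^ p" "x = of_int n * 2 powi e"
    using assms(1) F_iff by auto
  have "\<bar>real_of_int n\<bar> < 2 powi int p"
    using n(1) by (simp flip: of_int_abs)
  then have "\<bar>x\<bar> < 2 powi int p * 2 powi e"
    unfolding n(2) abs_mult by simp
  then have "2 powi k < (2::real) powi (int p + e)"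
    using assms(2) by (simp add: power_int_add)
  then have "k < int p + e"
    by (smt (verit) power_int_increasing)
  then obtain j where j: "e = k + 1 - int p + int j"
    by (metis add1_zle_eq le_diff_eq diff_add_cancel add_diff_eq diff_diff_eq2 add.commute zle_iff_zadd)
  have "x = of_int (n * 2 ^ j) * 2 powi (k + 1 - int p)"
    unfolding n(2) j by (simp add: power_int_add)
  then show ?thesis
    using that by blast
qed

lemma power_int_minus_p: "2 powi (k - int p) = u * 2 powi k"
  by (simp add: u_eq power_int_diff)

text \<open>In the binade below \<open>2 powi k\<close> the grid index is at most
  \<open>2 ^ p - 1\<close>, and one grid unit is \<open>u * 2 powi k\<close>.\<close>

lemma F_less_power_int:
  assumes "x \<in> F" "\<bar>x\<bar> < 2 powi k"
  shows "\<bar>x\<bar> \<le> (1 - u) * 2 powi k"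
proof (cases "2 powi (k - 1) \<le> \<bar>x\<bar>")
  case True
  with assms(1) obtain n :: int where n: "x = of_int n * 2 powi (k - int p)"
    using F_multiple[of x "k - 1"] by auto
  have "\<bar>real_of_int n\<bar> * 2 powi (k - int p) < 2 powi k"
    using assms(2) unfolding n abs_mult by simp
  then have "\<bar>real_of_int n\<bar> < 2 ^ p"
    by (simp add: power_int_diff field_simps)
  then have "\<bar>n\<bar> < 2 ^ p"
    by (simp flip: of_int_abs)
  then have "\<bar>n\<bar> \<le> 2 ^ p - 1"
    by simp
  then have "real_of_int \<bar>n\<bar> \<le> real_of_int (2 ^ p - 1)"
    by (simp only: of_int_le_iff)
  then have "(real_of_int \<bar>n\<bar> + 1) * 2 powi k \<le> 2 ^ p * 2 powi k"
    by (intro mult_right_mono) auto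
  then show ?thesis
    unfolding n abs_mult by (simp add: u_eq power_int_diff field_simps)
next
  case False
  then have "\<bar>x\<bar> \<le> 1 / 2 * 2 powi k"
    by (simp add: power_int_diff)
  also have "\<dots> \<le> (1 - u) * 2 powi k"
    using u_le by (intro mult_right_mono) auto
  finally show ?thesis .
qed

section \<open>Rounding to nearest even\<close>

text \<open>\<open>n = 2 ^ p\<close> is included because rounding within a binade can reach its
  upper end; there the normalized significand is \<open>2 ^ (p - 1)\<close>, still even.\<close>

lemma even_significand_of_int:
  fixes n :: int
  assumes "2 ^ (p - 1) \<le> n" "n \<le> 2 ^ p" "even n"
  shows "even_significand p (of_int n * 2 powi e)"
proof (cases "n = 2 ^ p")
  case True
  define q where "q = p - 2"
  have p: "p = Suc (Suc q)"
    using p_ge_3 by (simp add: q_def)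
  have "of_int n * (2::real) powi e = of_int (2 ^ Suc q) * 2 powi (e + 1)"
    by (simp add: True p power_int_add)
  then show ?thesis
    unfolding even_significand_iff using p
    by (intro disjI2 exI[of _ "2 ^ Suc q"] exI[of _ "e + 1"]) simp
next
  case False
  then have "2 ^ (p - 1) \<le> \<bar>n\<bar>" "\<bar>n\<bar> < 2 ^ p"
    using assms zero_le_power[of "2::int" "p - 1"] by linarith+
  then show ?thesis
    unfolding even_significand_iff using assms(3) by blast
qed

text \<open>Dividing by the spacing of the binade reduces rounding to the nearest integer.
  Uniqueness in a tie holds because the two candidates have significands of opposite parity.\<close>

lemma nearest_even_in_iff:
  fixes N :: int
  assumes r: "2 powi k \<le> r" "r < 2 powi (k + 1)"
    and N: "\<bar>of_int N - r / 2 powi (k + 1 - int p)\<bar> \<le> 1 / 2"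
      "\<bar>of_int N - r / 2 powi (k + 1 - int p)\<bar> = 1 / 2 \<Longrightarrow> even N"
  shows "nearest_even_in p F r f \<longleftrightarrow> f = of_int N * 2 powi (k + 1 - int p)"
proof -
  define q :: real where "q = 2 powi (k + 1 - int p)"
  define t where "t = r / q"
  define M :: int where "M = 2 ^ (p - 1)"
  have q: "q > 0"
    by (simp add: q_def)
  have rt: "r = t * q"
    using q by (simp add: t_def)
  obtain m where p: "p = Suc m"
    using p_ge_3 by (cases p) auto
  have Mq: "2 powi k = of_int M * q" "2 powi (k + 1) = 2 * of_int M * q"
    by (simp_all add: M_def q_def p power_int_diff power_int_add)
  have M2: "2 ^ p = 2 * M"
    by (simp add: M_def p)
  have t: "of_int M \<le> t" "t < 2 * of_int M"
    using r q unfolding Mq rt by simp_all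
  have tN: "\<bar>of_int N - t\<bar> \<le> 1 / 2" "\<bar>of_int N - t\<bar> = 1 / 2 \<Longrightarrow> even N"
    using N by (simp_all add: t_def q_def)
  have NM: "M \<le> N" "N \<le> 2 * M"
    using tN(1) t by linarith+
  have int: "\<bar>of_int N - t\<bar> \<le> \<bar>of_int j - t\<bar>" for j :: int
    using tN(1) by (cases "j < N"; cases "j = N"; linarith)
  have dist: "\<bar>r - of_int j * q\<bar> = \<bar>of_int j - t\<bar> * q" for j :: int
    using q unfolding rt by (simp add: abs_minus_commute flip: left_diff_distrib abs_mult_pos)
  \<comment> \<open>An element below \<open>2 powi k = of_int M * q\<close> is farther from
    \<open>r\<close> than \<open>2 powi k\<close>, which is a grid point and no better than
    \<open>N\<close>; so every competitor is a grid point.\<close>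
  have close: "\<exists>j. g = of_int j * q" if "g \<in> F" "\<bar>r - g\<bar> \<le> \<bar>r - of_int N * q\<bar>" for g
  proof (cases "2 powi k \<le> g")
    case True
    then show ?thesis
      using F_multiple[OF that(1), of k] unfolding q_def by (metis abs_ge_self order.trans)
  next
    case False
    then have "\<bar>r - of_int M * q\<bar> < \<bar>r - g\<bar>"
      using r(1) unfolding Mq by linarith
    then have "\<bar>r - of_int M * q\<bar> < \<bar>r - of_int N * q\<bar>"
      using that(2) by linarith
    then show ?thesis
      using int[of M] q unfolding dist by (simp add: not_less)
  qed
  have Nq: "of_int N * q \<in> F"
    unfolding q_def using NM M2 zero_le_power[of "2::int" "p - 1"]
    by (intro of_int_power_int_in_F) (simp add: M_def)
  have near: "nearest_in F r (of_int N * q)"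
    unfolding nearest_in_def
  proof (intro conjI ballI Nq)
    fix g
    assume "g \<in> F"
    show "\<bar>r - of_int N * q\<bar> \<le> \<bar>r - g\<bar>"
    proof (rule ccontr)
      assume *: "\<not> ?thesis"
      then obtain j :: int where j: "g = of_int j * q"
        using close[OF \<open>g \<in> F\<close>] by auto
      show False
        using * int[of j] q unfolding j dist by (simp add: not_less)
    qed
  qed
  \<comment> \<open>A second nearest grid point is a neighbour of \<open>N\<close>, both at distance
    1/2, hence odd. The upper end \<open>2 * M\<close> is even and thus excluded, which leaves
    \<open>j\<close> as a genuine \<open>p\<close>-digit significand.\<close>
  have tie: "\<exists>j::int. g = of_int j * q \<and> even N \<and> odd j \<and> M \<le> j \<and> j < 2 * M"
    if g: "nearest_in F r g" "g \<noteq> of_int N * q" for g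
  proof -
    have "g \<in> F" "\<bar>r - g\<bar> \<le> \<bar>r - of_int N * q\<bar>"
      using g Nq by (auto simp: nearest_in_def)
    then obtain j :: int where j: "g = of_int j * q" "\<bar>of_int j - t\<bar> \<le> \<bar>of_int N - t\<bar>"
      using close[of g] q dist by auto
    have "j \<noteq> N"
      using j g(2) by auto
    then have *: "\<bar>of_int N - t\<bar> = 1 / 2" "j = N + 1 \<or> j = N - 1"
      using j(2) tN(1) by linarith+
    then have "even N" "odd j"
      using tN(2) by auto
    moreover have "M \<le> j" "j \<le> 2 * M"
      using j(2) tN(1) t by linarith+
    moreover have "j \<noteq> 2 * M"
      using \<open>odd j\<close> by auto
    ultimately show ?thesis
      using j(1) by auto
  qed
  show ?thesis
    unfolding q_def[symmetric]
  proof
    assume f: "f = of_int N * q"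
    show "nearest_even_in p F r f"
      unfolding nearest_even_in_def
    proof (intro conjI impI)
      show "nearest_in F r f"
        using near f by simp
      assume "\<exists>g. g \<noteq> f \<and> nearest_in F r g"
      then have "even N"
        using tie f by blast
      then show "even_significand p f"
        unfolding f q_def using NM M2 by (intro even_significand_of_int) (simp_all add: M_def)
    qed
  next
    assume f: "nearest_even_in p F r f"
    show "f = of_int N * q"
    proof (rule ccontr)
      assume ne: "f \<noteq> of_int N * q"
      have "nearest_in F r f"
        using f by (simp add: nearest_even_in_def)
      then obtain j :: int where j: "f = of_int j * q" "odd j" "M \<le> j" "j < 2 * M"
        using tie ne by blast
      have "M > 0"
        by (simp add: M_def)
      have "even_significand p f"
        using f near ne by (auto simp: nearest_even_in_def)
      moreover have "f \<noteq> 0"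
        using j q \<open>M > 0\<close> by auto
      ultimately obtain n :: int and e where
        n: "M \<le> \<bar>n\<bar>" "\<bar>n\<bar> < 2 * M" "even n" "f = of_int n * 2 powi e"
        unfolding even_significand_iff M2 M_def by metis
      have eq: "of_int \<bar>n\<bar> * 2 powi e = of_int j * q"
      proof -
        have "of_int \<bar>n\<bar> * 2 powi e = \<bar>f\<bar>"
          by (simp add: n(4) abs_mult)
        also have "\<dots> = of_int j * q"
          unfolding j(1) using j(3) q \<open>M > 0\<close> by (intro abs_of_nonneg mult_nonneg_nonneg) auto
        finally show ?thesis .
      qed
      \<comment> \<open>Two \<open>p\<close>-digit significands represent the same number: comparing
        magnitudes from both sides pins \<open>e\<close> to the grid exponent, so \<open>n\<close>
        equals \<open>j\<close> up to sign, against parity.\<close>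
      have "of_int M * 2 powi e < 2 * of_int M * q"
      proof -
        have "of_int M * 2 powi e \<le> of_int \<bar>n\<bar> * (2 powi e :: real)"
          using n(1) by (intro mult_right_mono) auto
        also have "\<dots> < 2 * of_int M * q"
          unfolding eq using j(4) q by simp
        finally show ?thesis .
      qed
      then have "2 powi e < (2::real) powi (k + 1 - int p + 1)"
        using \<open>M > 0\<close> by (subst power_int_add) (simp_all add: q_def)
      then have 1: "e < k + 1 - int p + 1"
        by (smt (verit) power_int_increasing)
      have "of_int M * q < 2 * of_int M * 2 powi e"
      proof -
        have "of_int M * q \<le> of_int j * q"
          using j(3) q by (intro mult_right_mono) auto
        also have "\<dots> < 2 * of_int M * 2 powi e"
          unfolding eq[symmetric] using n(2) by simp
        finally show ?thesis .
      qed
      then have "2 powi (k + 1 - int p) < (2::real) powi (e + 1)"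
        using \<open>M > 0\<close> by (simp add: q_def power_int_add)
      then have "k + 1 - int p < e + 1"
        by (smt (verit) power_int_increasing)
      with 1 have "e = k + 1 - int p"
        by simp
      then have "n = j \<or> n = - j"
        using eq q by (simp add: q_def) linarith
      then show False
        using n(3) j(2) by auto
    qed
  qed
qed

section \<open>Compatibility of rounding with signs and powers of two\<close>

definition scaling :: "real \<Rightarrow> bool" where
  "scaling s \<longleftrightarrow> (\<exists>k. \<bar>s\<bar> = 2 powi k)"

lemma scaling_minus_one: "scaling (- 1)"
  unfolding scaling_def by (intro exI[of _ 0]) simp

lemma scaling_inverse: "scaling s \<Longrightarrow> scaling (inverse s)"
  unfolding scaling_def by (metis abs_inverse power_int_minus)

lemma scaling_nonzero: "scaling s \<Longrightarrow> s \<noteq> 0"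
  by (auto simp: scaling_def)

lemma scaling_of_int:
  assumes "scaling s"
  obtains l :: int and k where "l \<in> {1, - 1}" "s = of_int l * 2 powi k"
proof -
  obtain k where "\<bar>s\<bar> = 2 powi k"
    using assms by (auto simp: scaling_def)
  then have "s = of_int 1 * 2 powi k \<or> s = of_int (- 1) * 2 powi k"
    by auto
  then show ?thesis
    using that by (metis insertCI)
qed

lemma scaling_significand:
  fixes n :: int
  assumes "scaling s"
  obtains l :: int and e' where "l \<in> {1, - 1}" "s * (of_int n * 2 powi e) = of_int (l * n) * 2 powi e'"
proof -
  obtain l :: int and k where l: "l \<in> {1, - 1}" "s = of_int l * 2 powi k"
    using assms by (rule scaling_of_int)
  then have "s * (of_int n * 2 powi e) = of_int (l * n) * 2 powi (k + e)"
    by (simp add: power_int_add)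
  then show ?thesis
    using that l(1) by blast
qed

lemma scaling_in_F:
  assumes "scaling s" "x \<in> F"
  shows "s * x \<in> F"
proof (cases "x = 0")
  case False
  then obtain n :: int and e where n: "2 ^ (p - 1) \<le> \<bar>n\<bar>" "\<bar>n\<bar> < 2 ^ p" "x = of_int n * 2 powi e"
    using assms(2) F_iff by auto
  obtain l :: int and e' where l: "l \<in> {1, - 1}" "s * x = of_int (l * n) * 2 powi e'"
    unfolding n(3) using assms(1) by (rule scaling_significand)
  have "\<bar>l * n\<bar> = \<bar>n\<bar>"
    using l(1) by auto
  then show ?thesis
    unfolding l(2) using n(2) by (intro of_int_power_int_in_F) simp
qed (simp add: F_iff)

lemma scaling_even_significand:
  assumes "scaling s" "even_significand p x"
  shows "even_significand p (s * x)"
proof (cases "x = 0")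
  case False
  then obtain n :: int and e where
    n: "2 ^ (p - 1) \<le> \<bar>n\<bar>" "\<bar>n\<bar> < 2 ^ p" "even n" "x = of_int n * 2 powi e"
    using assms(2) even_significand_iff by auto
  obtain l :: int and e' where l: "l \<in> {1, - 1}" "s * x = of_int (l * n) * 2 powi e'"
    unfolding n(4) using assms(1) by (rule scaling_significand)
  have "\<bar>l * n\<bar> = \<bar>n\<bar>"
    using l(1) by auto
  then have "2 ^ (p - 1) \<le> \<bar>l * n\<bar>" "\<bar>l * n\<bar> < 2 ^ p" "even (l * n)"
    using n by simp_all
  then show ?thesis
    unfolding even_significand_iff l(2) by blast
qed (simp add: even_significand_iff)

lemma scaling_nearest_in:
  assumes "scaling s" "nearest_in F r f"
  shows "nearest_in F (s * r) (s * f)"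
  unfolding nearest_in_def
proof (intro conjI ballI)
  show "s * f \<in> F"
    using assms scaling_in_F by (simp add: nearest_in_def)
  fix g
  assume "g \<in> F"
  \<comment> \<open>A competitor \<open>g\<close> of \<open>s * f\<close> is pulled back to the
    competitor \<open>inverse s * g\<close> of \<open>f\<close>.\<close>
  then have "inverse s * g \<in> F"
    using assms scaling_in_F scaling_inverse by blast
  then have "\<bar>r - f\<bar> \<le> \<bar>r - inverse s * g\<bar>"
    using assms by (simp add: nearest_in_def)
  then have "\<bar>s\<bar> * \<bar>r - f\<bar> \<le> \<bar>s\<bar> * \<bar>r - inverse s * g\<bar>"
    by (simp add: mult_left_mono)
  then show "\<bar>s * r - s * f\<bar> \<le> \<bar>s * r - g\<bar>"
    using scaling_nonzero[OF assms(1)] by (simp add: right_diff_distrib mult.assoc[symmetric] flip: abs_mult)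
qed

lemma scaling_nearest_even_in:
  assumes s: "scaling s" and f: "nearest_even_in p F r f"
  shows "nearest_even_in p F (s * r) (s * f)"
  unfolding nearest_even_in_def
proof (intro conjI impI)
  show "nearest_in F (s * r) (s * f)"
    using s f scaling_nearest_in by (simp add: nearest_even_in_def)
  assume "\<exists>g. g \<noteq> s * f \<and> nearest_in F (s * r) g"
  then obtain g where g: "g \<noteq> s * f" "nearest_in F (s * r) g"
    by blast
  have "nearest_in F r (inverse s * g)"
    using scaling_nearest_in[OF scaling_inverse[OF s] g(2)] scaling_nonzero[OF s]
    by (simp add: mult.assoc[symmetric])
  moreover have "inverse s * g \<noteq> f"
    using g(1) scaling_nonzero[OF s] by (auto simp: field_simps)
  ultimately have "even_significand p f"
    using f by (auto simp: nearest_even_in_def)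
  then show "even_significand p (s * f)"
    using s scaling_even_significand by blast
qed

section \<open>Existence, uniqueness and monotonicity of rounding\<close>

lemma ex1_nearest_even_in: "\<exists>!f. nearest_even_in p F r f"
proof -
  have pos: "\<exists>!f. nearest_even_in p F r f" if r: "r > 0" for r
  proof -
    obtain k where k: "2 powi k \<le> r" "r < 2 powi (k + 1)"
      using ex_power_int_bounds[OF r] .
    obtain N :: int where "\<bar>of_int N - r / 2 powi (k + 1 - int p)\<bar> \<le> 1 / 2"
      "\<bar>of_int N - r / 2 powi (k + 1 - int p)\<bar> = 1 / 2 \<longrightarrow> even N"
      using ex_int_nearest_even by blast
    then show ?thesis
      using nearest_even_in_iff[OF k, of N] by simp
  qed
  consider "r > 0" | "r = 0" | "- r > 0"
    by linarith
  then show ?thesis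
  proof cases
    case 2
    have "0 \<in> F"
      by (simp add: F_iff)
    then have "nearest_even_in p F 0 f \<longleftrightarrow> f = 0" for f
      by (auto simp: nearest_even_in_def nearest_in_def even_significand_iff)
    then show ?thesis
      using 2 by simp
  next
    case 3
    have "nearest_even_in p F r f \<longleftrightarrow> nearest_even_in p F (- r) (- f)" for f
      using scaling_nearest_even_in[OF scaling_minus_one, of r f]
        scaling_nearest_even_in[OF scaling_minus_one, of "- r" "- f"] by auto
    then show ?thesis
      using pos[OF 3] by (metis minus_minus)
  qed (rule pos)
qed

lemma nearest_even_in_R: "nearest_even_in p F r (R r)"
  unfolding R_def by (rule theI') (rule ex1_nearest_even_in)

lemma R_eqI: "nearest_even_in p F r f \<Longrightarrow> R r = f"
  using nearest_even_in_R ex1_nearest_even_in by blast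

lemma R_scale: "scaling s \<Longrightarrow> R (s * r) = s * R r"
  by (intro R_eqI scaling_nearest_even_in nearest_even_in_R)

lemma R_minus: "R (- r) = - R r"
  using R_scale[OF scaling_minus_one, of r] by simp

lemma R_in_F: "R r \<in> F"
  using nearest_even_in_R[of r] by (simp add: nearest_even_in_def nearest_in_def)

lemma R_nearest: "g \<in> F \<Longrightarrow> \<bar>R r - r\<bar> \<le> \<bar>g - r\<bar>"
  using nearest_even_in_R[of r] by (simp add: nearest_even_in_def nearest_in_def abs_minus_commute)

lemma R_of_F: "x \<in> F \<Longrightarrow> R x = x"
  using R_nearest[of x x] by simp

lemma R_le: "r \<le> f \<Longrightarrow> f \<in> F \<Longrightarrow> R r \<le> f"
  using R_nearest[of f r] R_of_F[of r] by (cases "r = f") (simp, linarith)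

lemma R_ge: "f \<le> r \<Longrightarrow> f \<in> F \<Longrightarrow> f \<le> R r"
  using R_le[of "- r" "- f"] by (simp add: R_minus uminus_in_F_iff)

lemma abs_R_le: "\<bar>r\<bar> \<le> f \<Longrightarrow> f \<in> F \<Longrightarrow> \<bar>R r\<bar> \<le> f"
  using R_le[of r f] R_ge[of "- f" r] by (simp add: uminus_in_F_iff abs_le_iff)

text \<open>If \<open>R r\<close> exceeded \<open>R s\<close>, nearness would put \<open>r\<close>
  at or above their midpoint and \<open>s\<close> at or below it, against
  \<open>r < s\<close>.\<close>

lemma R_mono: "r \<le> s \<Longrightarrow> R r \<le> R s"
  using R_nearest[OF R_in_F, of r s] R_nearest[OF R_in_F, of s r] by (cases "r = s") (simp, linarith)

section \<open>Absolute and relative rounding errors\<close>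

lemma R_error:
  assumes "\<bar>r\<bar> \<le> 2 powi k"
  shows "\<bar>R r - r\<bar> \<le> u / 2 * 2 powi k"
proof -
  define q :: real where "q = 2 powi (k - int p)"
  have q: "q > 0" "2 powi k = 2 ^ p * q" "q = u * 2 powi k"
    by (simp_all add: q_def power_int_diff power_int_minus_p u_eq)
  \<comment> \<open>All multiples of \<open>q\<close> up to \<open>2 ^ p * q = 2 powi k\<close> are
    representable, so the one nearest to \<open>r\<close> competes with \<open>R r\<close>.\<close>
  define j where "j = round (r / q)"
  have j: "\<bar>of_int j - r / q\<bar> \<le> 1 / 2"
    unfolding j_def by (rule of_int_round_abs_le)
  have "\<bar>r / q\<bar> \<le> of_int (2 ^ p)"
    using assms q(1) by (simp add: q(2) abs_mult field_simps)
  then have "\<bar>j\<bar> \<le> 2 ^ p"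
    using j by linarith
  then have "of_int j * q \<in> F"
    unfolding q_def by (rule of_int_power_int_in_F)
  then have "\<bar>R r - r\<bar> \<le> \<bar>of_int j * q - r\<bar>"
    by (rule R_nearest)
  also have "of_int j * q - r = (of_int j - r / q) * q"
    using q(1) by (simp add: field_simps)
  also have "\<bar>\<dots>\<bar> \<le> 1 / 2 * q"
    unfolding abs_mult using j q(1) by (intro mult_mono) auto
  finally show ?thesis
    by (simp add: q(3))
qed

text \<open>Just past \<open>2 powi k\<close>, that power itself is within \<open>\<eta>\<close>; a
  small overshoot thus avoids the doubled error of the next binade.\<close>

lemma R_error_slack:
  assumes "\<bar>r\<bar> \<le> 2 powi k + \<eta>" "u / 2 * 2 powi k \<le> \<eta>"
  shows "\<bar>R r - r\<bar> \<le> \<eta>"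
proof (cases "\<bar>r\<bar> \<le> 2 powi k")
  case True
  then show ?thesis
    using R_error[of r k] assms(2) by linarith
next
  case False
  then show ?thesis
    using R_nearest[of "2 powi k" r] R_nearest[of "- (2 powi k)" r] assms(1)
      power_int_in_F[of k] uminus_in_F_iff by (smt (verit))
qed

text \<open>If \<open>\<bar>r\<bar>\<close> exceeded \<open>2 powi k\<close>, its rounding could not
  fall below it. This bounds the low parts \<open>x1\<close> and \<open>y1\<close> by the size of
  the high parts.\<close>

lemma R_error_of_R_less:
  assumes "\<bar>R r\<bar> < 2 powi k"
  shows "\<bar>R r - r\<bar> \<le> u / 2 * 2 powi k"
proof -
  have "\<bar>r\<bar> \<le> 2 powi k"
    using assms R_ge[of "2 powi k" r] R_le[of r "- (2 powi k)"] power_int_in_F[of k] uminus_in_F_iff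
    by (smt (verit))
  then show ?thesis
    by (rule R_error)
qed

lemma R_rel_error: "\<bar>R r - r\<bar> \<le> u * \<bar>r\<bar>"
proof (cases "r = 0")
  case True
  then show ?thesis
    using R_of_F[of 0] by (simp add: F_iff)
next
  case False
  then obtain k where k: "2 powi k \<le> \<bar>r\<bar>" "\<bar>r\<bar> < 2 powi (k + 1)"
    using ex_power_int_bounds[of "\<bar>r\<bar>"] by (metis zero_less_abs_iff)
  have "\<bar>R r - r\<bar> \<le> u / 2 * 2 powi (k + 1)"
    using k(2) by (intro R_error) simp
  also have "\<dots> = u * 2 powi k"
    by (simp add: power_int_add)
  also have "\<dots> \<le> u * \<bar>r\<bar>"
    using k(1) u_pos by (intro mult_left_mono) auto
  finally show ?thesis .
qed

text \<open>The binade of the result replaces that of the argument; a zero result forces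
  \<open>r = 0\<close> because \<open>u < 1\<close>.\<close>

lemma R_rel_error_R: "\<bar>R r - r\<bar> \<le> u * \<bar>R r\<bar>"
proof (cases "R r = 0")
  case True
  then have "(1 - u) * \<bar>r\<bar> \<le> 0"
    using R_rel_error[of r] by (simp add: algebra_simps)
  then show ?thesis
    using True u_le by (simp add: mult_le_0_iff)
next
  case False
  then obtain k where k: "2 powi k \<le> \<bar>R r\<bar>" "\<bar>R r\<bar> < 2 powi (k + 1)"
    using ex_power_int_bounds[of "\<bar>R r\<bar>"] by (metis zero_less_abs_iff)
  have "\<bar>R r - r\<bar> \<le> u / 2 * 2 powi (k + 1)"
    using k(2) by (rule R_error_of_R_less)
  also have "\<dots> = u * 2 powi k"
    by (simp add: power_int_add)
  also have "\<dots> \<le> u * \<bar>R r\<bar>"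
    using k(1) u_pos by (intro mult_left_mono) auto
  finally show ?thesis .
qed

text \<open>The argument is midway between \<open>2 powi k\<close> and its successor
  \<open>(1 + 2 * u) * 2 powi k\<close>, and the former has the even significand
  \<open>2 ^ (p - 1)\<close>.\<close>

lemma R_tie: "R ((1 + u) * 2 powi k) = 2 powi k"
proof -
  obtain m where p: "p = Suc m"
    using p_ge_3 by (cases p) auto
  have "m > 0"
    using p_ge_3 p by simp
  have *: "(1 + u) * 2 powi k / 2 powi (k + 1 - int p) = 2 ^ m + 1 / 2"
    unfolding u_eq by (simp add: p power_int_diff field_simps)
  have "nearest_even_in p F ((1 + u) * 2 powi k) (2 powi k) \<longleftrightarrow>
    (2 powi k :: real) = of_int (2 ^ m) * 2 powi (k + 1 - int p)"
    using u_pos u_le \<open>m > 0\<close>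
    by (intro nearest_even_in_iff) (simp_all only: *, simp_all add: power_int_add)
  then have "nearest_even_in p F ((1 + u) * 2 powi k) (2 powi k)"
    by (simp add: p power_int_diff)
  then show ?thesis
    by (rule R_eqI)
qed

lemma abs_R_le_of_tie:
  assumes "\<bar>r\<bar> \<le> (1 + u) * 2 powi k"
  shows "\<bar>R r\<bar> \<le> 2 powi k"
  using R_mono[of r "(1 + u) * 2 powi k"] R_mono[of "- ((1 + u) * 2 powi k)" r] assms
  by (simp only: R_tie R_minus; linarith)

text \<open>Sterbenz's lemma: both numbers lie on the grid of the binade of \<open>x\<close>, and
  their difference is at most \<open>x\<close>, hence at most \<open>2 ^ p\<close> grid
  units.\<close>

lemma F_diff:
  assumes "x \<in> F" "y \<in> F" "0 < x" "x \<le> y" "y \<le> 2 * x"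
  shows "y - x \<in> F"
proof -
  obtain k where k: "2 powi k \<le> x" "x < 2 powi (k + 1)"
    using ex_power_int_bounds[OF assms(3)] .
  obtain n m :: int where nm: "x = of_int n * 2 powi (k + 1 - int p)" "y = of_int m * 2 powi (k + 1 - int p)"
    using F_multiple[of x k] F_multiple[of y k] assms k by (metis abs_of_pos order.trans order.strict_trans2)
  have "y - x = of_int (m - n) * 2 powi (k + 1 - int p)"
    unfolding nm by (simp add: left_diff_distrib)
  moreover have "\<bar>m - n\<bar> \<le> 2 ^ p"
  proof -
    have "\<bar>y - x\<bar> \<le> 2 powi (k + 1)"
      using assms k by linarith
    then have "\<bar>real_of_int (m - n)\<bar> * 2 powi (k + 1 - int p) \<le> 2 ^ p * 2 powi (k + 1 - int p)"
      unfolding \<open>y - x = _\<close> abs_mult by (simp add: power_int_diff)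
    then have "\<bar>real_of_int (m - n)\<bar> \<le> 2 ^ p"
      by simp
    then show ?thesis
      by (simp flip: of_int_abs of_int_diff)
  qed
  ultimately show ?thesis
    using of_int_power_int_in_F by metis
qed

section \<open>Rounding bounds at the scale of \<open>u\<close>\<close>

lemma u_mult_in_F: "u * 2 powi k \<in> F"
  using power_int_in_F[of "k - int p"] by (simp only: power_int_minus_p)

lemma R_error_u: "\<bar>r\<bar> \<le> u * 2 powi k \<Longrightarrow> \<bar>R r - r\<bar> \<le> u\<^sup>2 / 2 * 2 powi k"
  using R_error[of r "k - int p"] by (simp add: power_int_minus_p power2_eq_square)

lemma R_error_slack_u:
  "\<bar>r\<bar> \<le> u * 2 powi k + \<eta> \<Longrightarrow> u\<^sup>2 / 2 * 2 powi k \<le> \<eta> \<Longrightarrow> \<bar>R r - r\<bar> \<le> \<eta>"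
  using R_error_slack[of r "k - int p" \<eta>] by (simp add: power_int_minus_p power2_eq_square)

lemma abs_R_le_of_tie_u: "\<bar>r\<bar> \<le> u * 2 powi k * (1 + u) \<Longrightarrow> \<bar>R r\<bar> \<le> u * 2 powi k"
  using abs_R_le_of_tie[of r "k - int p"] by (simp only: power_int_minus_p) (simp add: mult.commute)

section \<open>The error of the algorithm\<close>

text \<open>Since TwoSum is exact, only the last two floating-point additions lose anything. Their total
  error depends on the inputs only through \<open>h = x0 + y0\<close> and \<open>l = x1 + y1\<close>.\<close>

definition madd_error :: "real \<Rightarrow> real \<Rightarrow> real" where
  "madd_error h l =
     (let b = h - R h; d = l - R l; c' = R h + R l - R (R h + R l)
      in R (R (b + d) + c') - (b + d + c'))"

lemma madd_error_scale:
  assumes "scaling s"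
  shows "madd_error (s * h) (s * l) = s * madd_error h l"
  unfolding madd_error_def Let_def
  by (simp only: R_scale[OF assms] flip: distrib_left right_diff_distrib)

lemma constants_in_F:
  "0 \<in> F" "1 \<in> F" "2 \<in> F" "4 \<in> F" "u \<in> F" "2 * u \<in> F"
  using power_int_in_F[of 0] power_int_in_F[of 1] power_int_in_F[of 2]
    u_mult_in_F[of 0] u_mult_in_F[of 1] by (simp_all add: mult.commute F_iff[of 0])

lemma u_square_le: "u\<^sup>2 \<le> u / 8" "u\<^sup>2 > 0"
  using u_le u_pos by (simp_all add: power2_eq_square)

lemma F_less_2: "x \<in> F \<Longrightarrow> \<bar>x\<bar> < 2 \<Longrightarrow> \<bar>x\<bar> \<le> 2 - 2 * u"
  using F_less_power_int[of x 1] by (simp add: algebra_simps)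

lemma F_less_1: "x \<in> F \<Longrightarrow> \<bar>x\<bar> < 1 \<Longrightarrow> \<bar>x\<bar> \<le> 1 - u"
  using F_less_power_int[of x 0] by simp

lemma F_less_half: "x \<in> F \<Longrightarrow> \<bar>x\<bar> < 1 / 2 \<Longrightarrow> \<bar>x\<bar> \<le> 1 / 2 - u / 2"
  using F_less_power_int[of x "- 1"] by (simp add: power_int_minus algebra_simps)

section \<open>Error bounds by the range of \<open>h\<close>\<close>

lemma madd_error_ge_2:
  assumes h: "2 \<le> R h" "h \<le> 4" and l: "\<bar>l\<bar> \<le> 2 * u"
  shows "\<bar>madd_error h l\<bar> \<le> 3 * u\<^sup>2"
proof -
  define a b c d where "a = R h" and "b = h - a" and "c = R l" and "d = l - c"
  define c' where "c' = a + c - R (a + c)"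
  have "h \<ge> 0"
    using R_le[of h 0] h(1) constants_in_F by (smt (verit))
  then have b: "\<bar>b\<bar> \<le> 2 * u"
    using R_error[of h 2] h(2) by (simp add: a_def b_def; linarith)
  have a: "2 \<le> a" "a \<le> 4"
    using h R_le[of h 4] constants_in_F by (simp_all add: a_def)
  have c: "\<bar>c\<bar> \<le> 2 * u"
    unfolding c_def using l constants_in_F by (intro abs_R_le)
  have d: "\<bar>d\<bar> \<le> u\<^sup>2"
    using R_error_u[of l 1] l by (simp add: c_def d_def; linarith)
  \<comment> \<open>\<open>a + c\<close> overshoots 4 by at most \<open>2 * u\<close>, the very
    error allowed for arguments up to 4. The two roundings below overshoot \<open>2 * u\<close> and
    \<open>4 * u\<close> equally harmlessly, contributing \<open>u\<^sup>2\<close> and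
    \<open>2 * u\<^sup>2\<close>.\<close>
  have c': "\<bar>c'\<bar> \<le> 2 * u"
    using R_error_slack[of "a + c" 2 "2 * u"] a c u_le by (simp add: c'_def; linarith)
  have 1: "\<bar>R (b + d) - (b + d)\<bar> \<le> u\<^sup>2"
    using R_error_slack_u[of "b + d" 1 "u\<^sup>2"] b d by simp
  have 2: "\<bar>R (R (b + d) + c') - (R (b + d) + c')\<bar> \<le> 2 * u\<^sup>2"
    using R_error_slack_u[of "R (b + d) + c'" 2 "2 * u\<^sup>2"] 1 b d c' by simp
  show ?thesis
    using 1 2 by (simp add: madd_error_def Let_def flip: a_def c_def b_def d_def c'_def)
qed

lemma madd_error_ge_1:
  assumes h: "1 \<le> h" "R h < 2" and l: "\<bar>l\<bar> \<le> 2 * u"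
  shows "\<bar>madd_error h l\<bar> \<le> 2 * u\<^sup>2"
proof -
  define a b c d where "a = R h" and "b = h - a" and "c = R l" and "d = l - c"
  define c' where "c' = a + c - R (a + c)"
  have "h \<le> 2"
    using R_ge[of 2 h] h(2) constants_in_F by linarith
  then have b: "\<bar>b\<bar> \<le> u"
    using R_error[of h 1] h(1) by (simp add: a_def b_def; linarith)
  \<comment> \<open>The gap of \<open>2 * u\<close> below 2 absorbs \<open>c\<close>, so
    \<open>a + c\<close> does not exceed 2 and \<open>c'\<close> stays within
    \<open>u\<close>.\<close>
  have a: "1 \<le> a" "a \<le> 2 - 2 * u"
    using h R_ge[of 1 h] constants_in_F F_less_2[OF R_in_F, of h] by (simp_all add: a_def)
  have c: "\<bar>c\<bar> \<le> 2 * u"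
    unfolding c_def using l constants_in_F by (intro abs_R_le)
  have d: "\<bar>d\<bar> \<le> u\<^sup>2"
    using R_error_u[of l 1] l by (simp add: c_def d_def; linarith)
  have c': "\<bar>c'\<bar> \<le> u"
    using R_error[of "a + c" 1] a c u_le by (simp add: c'_def; linarith)
  have 1: "\<bar>R (b + d) - (b + d)\<bar> \<le> u\<^sup>2"
    using R_error_slack_u[of "b + d" 0 "u\<^sup>2"] b d by simp
  \<comment> \<open>The bound \<open>u + u\<^sup>2\<close> on \<open>b + d\<close> is exactly the
    tie above \<open>u\<close>, which rounds down; the last addition then stays within
    \<open>2 * u\<close>.\<close>
  have "\<bar>R (b + d)\<bar> \<le> u"
    using abs_R_le_of_tie_u[of "b + d" 0] b d by (simp add: algebra_simps power2_eq_square)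
  then have 2: "\<bar>R (R (b + d) + c') - (R (b + d) + c')\<bar> \<le> u\<^sup>2"
    using R_error_u[of "R (b + d) + c'" 1] c' by simp
  show ?thesis
    using 1 2 by (simp add: madd_error_def Let_def flip: a_def c_def b_def d_def c'_def)
qed

text \<open>This is the successor of \<open>u / 2\<close>, with integer significand
  \<open>2 ^ (p - 1) + 1\<close>. It lets the bound on \<open>b + d\<close> in the next lemma pass
  through rounding unchanged.\<close>

lemma half_u_plus_in_F: "u / 2 + u\<^sup>2 \<in> F"
proof -
  obtain m where p: "p = Suc m"
    using p_ge_3 by (cases p) auto
  have "2 powi (- int p - int p) = u * u"
    by (simp only: power_int_minus_p) (simp add: u_def)
  moreover have "2 ^ m * u = 1 / 2"
    unfolding u_eq by (simp add: p)
  ultimately have "u / 2 + u\<^sup>2 = of_int (2 ^ m + 1) * 2 powi (- int p - int p)"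
    by (simp add: algebra_simps power2_eq_square)
  moreover have "\<bar>2 ^ m + 1 :: int\<bar> \<le> 2 ^ p"
    by (simp add: p)
  ultimately show ?thesis
    using of_int_power_int_in_F by metis
qed

lemma madd_error_less_1:
  assumes h: "1 / 2 \<le> h" "h \<le> 1" and l: "\<bar>l\<bar> \<le> 5 / 4 * u"
  shows "R h = 1 \<and> \<bar>madd_error h l\<bar> \<le> 3 / 2 * u\<^sup>2 \<or> \<bar>madd_error h l\<bar> \<le> u\<^sup>2"
proof -
  define a b c d where "a = R h" and "b = h - a" and "c = R l" and "d = l - c"
  define c' where "c' = a + c - R (a + c)"
  have b: "\<bar>b\<bar> \<le> u / 2"
    using R_error[of h 0] h by (simp add: a_def b_def abs_minus_commute)
  have "1 / 2 \<in> F"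
    using power_int_in_F[of "- 1"] by (simp add: power_int_minus field_simps)
  then have a: "1 / 2 \<le> a" "a \<le> 1"
    using h R_ge[of "1 / 2" h] R_le[of h 1] constants_in_F by (simp_all add: a_def)
  have d: "\<bar>d\<bar> \<le> u\<^sup>2"
    using R_error_u[of l 1] l u_pos by (simp add: c_def d_def; linarith)
  have c: "\<bar>c\<bar> \<le> 5 / 4 * u + u\<^sup>2"
    using l d unfolding d_def by linarith
  have 1: "\<bar>R (b + d) - (b + d)\<bar> \<le> u\<^sup>2 / 2"
    using R_error_u[of "b + d" 0] b d u_square_le by simp
  have b': "\<bar>R (b + d)\<bar> \<le> u / 2 + u\<^sup>2"
    using b d half_u_plus_in_F by (intro abs_R_le) linarith+
  have err: "madd_error h l = R (R (b + d) + c') - (b + d + c')"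
    by (simp add: madd_error_def Let_def flip: a_def c_def b_def d_def c'_def)
  show ?thesis
  proof (cases "a = 1")
    case True
    have "\<bar>c'\<bar> \<le> u"
      using R_error[of "a + c" 1] a c u_le u_square_le by (simp add: c'_def; linarith)
    then have "\<bar>R (R (b + d) + c') - (R (b + d) + c')\<bar> \<le> u\<^sup>2"
      using R_error_u[of "R (b + d) + c'" 1] b' u_square_le u_pos by simp
    then show ?thesis
      using 1 True unfolding err a_def by linarith
  next
    case False
    then have a1: "a \<le> 1 - u"
      using a F_less_1[OF R_in_F, of h] by (simp add: a_def)
    \<comment> \<open>The gap \<open>u\<close> below 1 offsets most of \<open>c\<close>; the
      remainder \<open>u / 4 + u\<^sup>2\<close> is below \<open>u / 2\<close>, so \<open>c'\<close>
      keeps the error bound of arguments up to 1.\<close>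
    have "\<bar>a + c\<bar> \<le> 1 + u / 2"
      using a(1) a1 c u_le u_square_le by linarith
    then have c': "\<bar>c'\<bar> \<le> u / 2"
      using R_error_slack[of "a + c" 0 "u / 2"] by (simp add: c'_def abs_minus_commute)
    show ?thesis
    proof (cases "\<bar>R (b + d) + c'\<bar> \<le> u")
      case True
      then have "\<bar>R (R (b + d) + c') - (R (b + d) + c')\<bar> \<le> u\<^sup>2 / 2"
        using R_error_u[of "R (b + d) + c'" 0] by simp
      then show ?thesis
        using 1 unfolding err by linarith
    next
      case False
      \<comment> \<open>Adding up the bounds for the two roundings gives only \<open>3 u\<^sup>2 / 2\<close>; instead, compare
        the result, which is \<open>u\<close> or \<open>- u\<close>, with the exact \<open>b + d + c'\<close>.\<close>
      have "\<bar>R (R (b + d) + c')\<bar> \<le> u"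
        using abs_R_le_of_tie_u[of "R (b + d) + c'" 0] b' c' by (simp add: algebra_simps power2_eq_square)
      moreover have "R (b + d) + c' \<ge> u \<and> R (R (b + d) + c') \<ge> u \<or>
          R (b + d) + c' \<le> - u \<and> R (R (b + d) + c') \<le> - u"
        using False R_ge[of u "R (b + d) + c'"] R_le[of "R (b + d) + c'" "- u"]
          constants_in_F uminus_in_F_iff[of u] by linarith
      ultimately have "R (b + d) + c' \<ge> u \<and> R (R (b + d) + c') = u \<or>
          R (b + d) + c' \<le> - u \<and> R (R (b + d) + c') = - u"
        using u_pos by linarith
      then show ?thesis
        using 1 b c' d unfolding err by linarith
    qed
  qed
qed

text \<open>Here \<open>b = 0\<close>, and the representable \<open>d\<close> survives
  \<open>R (b + d)\<close> unchanged, so only the rounding of \<open>d + c'\<close> loses anything.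
  The condition on \<open>R l\<close> rules out \<open>- R l > 2 * h > 0\<close>, where neither
  argument below would apply.\<close>

lemma madd_error_exact:
  assumes h: "h \<in> F" "h \<ge> 0" "h = 0 \<or> \<bar>R l\<bar> \<le> 2 * h" and d: "l - R l \<in> F"
  shows "\<bar>madd_error h l\<bar> \<le> 2 * u\<^sup>2 * (1 + 2 * u) * \<bar>h + l\<bar>"
proof -
  define c d where "c = R l" and "d = l - c"
  define c' where "c' = h + c - R (h + c)"
  have err: "madd_error h l = R (d + c') - (d + c')"
    using d R_of_F[OF h(1)] R_of_F[OF d]
    by (simp add: madd_error_def Let_def flip: c_def d_def c'_def)
  have nonneg: "0 \<le> 2 * u\<^sup>2 * (1 + 2 * u) * \<bar>h + l\<bar>"
    using u_pos by simp
  have "c \<in> F"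
    unfolding c_def by (rule R_in_F)
  have exact: ?thesis if "h + c \<in> F"
  proof -
    have "c' = 0"
      using R_of_F[OF that] by (simp add: c'_def; linarith)
    then have "madd_error h l = 0"
      unfolding err using R_of_F[OF d] by (simp add: d_def c_def)
    then show ?thesis
      using nonneg by simp
  qed
  have bound: ?thesis if c: "\<bar>c\<bar> \<le> \<bar>h + c\<bar>"
  proof -
    define v where "v = \<bar>h + c\<bar>"
    have "\<bar>d\<bar> \<le> u * v"
    proof -
      have "\<bar>d\<bar> \<le> u * \<bar>c\<bar>"
        using R_rel_error_R[of l] by (simp add: d_def c_def abs_minus_commute)
      also have "\<dots> \<le> u * v"
        unfolding v_def using c u_pos by (intro mult_left_mono) auto
      finally show ?thesis .
    qed
    moreover have "\<bar>c'\<bar> \<le> u * v"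
      using R_rel_error[of "h + c"] by (simp add: c'_def v_def abs_minus_commute)
    ultimately have "u * \<bar>d + c'\<bar> \<le> u * (2 * (u * v))"
      using u_pos by (intro mult_left_mono) auto
    then have "\<bar>madd_error h l\<bar> \<le> 2 * u\<^sup>2 * v"
      using R_rel_error[of "d + c'"] by (simp add: err power2_eq_square algebra_simps)
    \<comment> \<open>Passing from \<open>h + c\<close> to \<open>h + l\<close> costs a factor
      \<open>1 - u\<close>, and \<open>(1 + 2 * u) * (1 - u) \<ge> 1\<close>.\<close>
    also have "v \<le> (1 + 2 * u) * \<bar>h + l\<bar>"
    proof -
      have "\<bar>h + l\<bar> \<ge> v - u * v"
        using \<open>\<bar>d\<bar> \<le> u * v\<close> by (simp add: d_def v_def)
      then have "(1 + 2 * u) * \<bar>h + l\<bar> \<ge> (1 + 2 * u) * (v - u * v)"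
        using u_pos by (intro mult_left_mono) auto
      moreover have "(1 + 2 * u) * (v - u * v) = v + u * v * (1 - 2 * u)"
        by (simp add: algebra_simps)
      moreover have "u * v * (1 - 2 * u) \<ge> 0"
        using u_pos u_le by (simp add: v_def)
      ultimately show ?thesis
        by linarith
    qed
    finally show ?thesis
      by (simp add: mult_left_mono mult.assoc)
  qed
  \<comment> \<open>For \<open>- c < h / 2\<close>, the sum \<open>h + c\<close> exceeds
    \<open>h / 2\<close> and hence \<open>- c\<close>; when \<open>- c\<close> and \<open>h\<close>
    are within a factor of two, Sterbenz makes \<open>h + c\<close> representable.\<close>
  consider "h = 0" | "c \<ge> 0" | "h > 0" "c < 0" "- c < h / 2" | "h > 0" "c < 0" "h / 2 \<le> - c" "- c \<le> 2 * h"
    using h by (auto simp: c_def) linarith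
  then show ?thesis
  proof cases
    case 1
    then show ?thesis
      using \<open>c \<in> F\<close> by (intro exact) simp
  next
    case 2
    then show ?thesis
      using h(2) by (intro bound) simp
  next
    case 3
    then show ?thesis
      by (intro bound) simp
  next
    case 4
    have "- c \<in> F"
      using \<open>c \<in> F\<close> by (simp add: uminus_in_F_iff)
    then have "h + c \<in> F"
      using F_diff[of "- c" h] F_diff[of h "- c"] h(1) 4 uminus_in_F_iff[of "h + c"]
      by (cases "- c \<le> h") (simp_all add: minus_diff_commute)
    then show ?thesis
      by (rule exact)
  qed
qed

section \<open>Combining the cases after normalization\<close>

lemma madd_error_normalized:
  assumes x: "x0 \<in> F" "1 \<le> x0" "x0 < 2" "R (x0 + x1) = x0"
    and y: "y0 \<in> F" "\<bar>y0\<bar> \<le> x0" "R (y0 + y1) = y0"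
    and d: "x1 + y1 - R (x1 + y1) \<in> F"
  shows "\<bar>madd_error (x0 + y0) (x1 + y1)\<bar> \<le> 2 * u\<^sup>2 * (1 + 2 * u) * \<bar>x0 + y0 + (x1 + y1)\<bar>"
proof -
  define h l where "h = x0 + y0" and "l = x1 + y1"
  define w where "w = u * u"
  have uu: "w \<le> u / 8" "u > 0" "u \<le> 1 / 8"
    using u_square_le u_pos u_le by (simp_all add: w_def power2_eq_square)
  have w: "u * u = w" "u * (u * t) = w * t" for t
    by (simp_all add: w_def mult.assoc)
  have x1: "\<bar>x1\<bar> \<le> u"
    using R_error_of_R_less[of "x0 + x1" 1] x by simp
  have y1: "\<bar>y1\<bar> \<le> u / 2 * 2 powi k" if "\<bar>y0\<bar> < 2 powi k" for k
    using R_error_of_R_less[of "y0 + y1" k] y(3) that by simp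
  have "\<bar>l\<bar> \<le> 2 * u"
    using x1 y1[of 1] x(3) y(2) unfolding l_def by simp
  \<comment> \<open>Each case with \<open>h\<close> not representable supplies the error in units of
    \<open>u\<^sup>2\<close> and a lower bound of the exact sum; only a numeric inequality in
    \<open>u\<close> is then left.\<close>
  have bound: "\<bar>madd_error h l\<bar> \<le> 2 * u\<^sup>2 * (1 + 2 * u) * \<bar>h + l\<bar>"
    if "\<bar>madd_error h l\<bar> \<le> t * u\<^sup>2" "s \<le> h + l" "t \<le> 2 * (1 + 2 * u) * s" for s t
  proof -
    have "2 * (1 + 2 * u) * s \<le> 2 * (1 + 2 * u) * \<bar>h + l\<bar>"
      using that(2) uu(2) by (intro mult_left_mono) auto
    then have "t * u\<^sup>2 \<le> 2 * (1 + 2 * u) * \<bar>h + l\<bar> * u\<^sup>2"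
      using that(3) by (intro mult_right_mono) auto
    then show ?thesis
      using that(1) by (simp add: algebra_simps)
  qed
  have grid: "\<exists>n::int. h = of_int n * u" if "1 / 2 \<le> \<bar>y0\<bar>"
  proof -
    have *: "2 powi (- 1) = (1 / 2 :: real)" "2 powi (- 1 + 1 - int p) = u"
      by (simp_all add: u_def power_int_minus)
    have "2 powi (- 1) \<le> \<bar>x0\<bar>" "2 powi (- 1) \<le> \<bar>y0\<bar>"
      using x(2) that unfolding * by simp_all
    then obtain n m :: int where "x0 = of_int n * u" "y0 = of_int m * u"
      using x(1) y(1) F_multiple[of _ "- 1"] unfolding *(2) by metis
    then have "h = of_int (n + m) * u"
      by (simp add: h_def algebra_simps)
    then show ?thesis
      by blast
  qed
  have "\<bar>madd_error h l\<bar> \<le> 2 * u\<^sup>2 * (1 + 2 * u) * \<bar>h + l\<bar>"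
  proof (cases "h \<in> F")
    case True
    have "\<bar>R l\<bar> \<le> 2 * u"
      using \<open>\<bar>l\<bar> \<le> 2 * u\<close> constants_in_F by (intro abs_R_le)
    have "h \<ge> 0"
      using y(2) by (simp add: h_def)
    \<comment> \<open>This gives \<open>\<bar>R l\<bar> \<le> 2 * u \<le> 2 * h\<close>, as the
      representable case requires.\<close>
    have "h \<ge> u" if "h \<noteq> 0"
    proof (cases "1 / 2 \<le> \<bar>y0\<bar>")
      case True
      then obtain n :: int where n: "h = of_int n * u"
        using grid by auto
      then have "n > 0"
        using that \<open>h \<ge> 0\<close> uu(2) by (simp add: zero_le_mult_iff)
      then show ?thesis
        unfolding n using uu(2) by simp
    next
      case False
      then show ?thesis
        using x(2) uu by (simp add: h_def)
    qed
    then show ?thesis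
      using madd_error_exact[of h l] True \<open>h \<ge> 0\<close> \<open>\<bar>R l\<bar> \<le> 2 * u\<close> d by (fastforce simp: l_def)
  next
    case False
    consider "2 \<le> R h" | "1 \<le> h" "R h < 2" | "h < 1"
      by linarith
    then show ?thesis
    proof cases
      case 1
      have "h \<le> 4" "h \<ge> 0"
        using x y(2) by (simp_all add: h_def)
      then have "\<bar>R h - h\<bar> \<le> 2 * u"
        using R_error[of h 2] by simp
      then have "2 - 4 * u \<le> h + l"
        using 1 \<open>\<bar>l\<bar> \<le> 2 * u\<close> by linarith
      then show ?thesis
        using madd_error_ge_2[OF 1 \<open>h \<le> 4\<close> \<open>\<bar>l\<bar> \<le> 2 * u\<close>] uu
        by (intro bound[of 3 "2 - 4 * u"]) (simp_all add: algebra_simps w)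
    next
      case 2
      have "h < 2"
        using 2 R_ge[of 2 h] constants_in_F by linarith
      \<comment> \<open>Both \<open>h\<close> and \<open>x0\<close> lie between 1 and 2, so
        \<open>\<bar>y0\<bar> < 1\<close>, which halves the bound on \<open>y1\<close>. From
        \<open>\<bar>l\<bar> \<le> 2 * u\<close> alone the sum would only be at least
        \<open>1 - 2 * u\<close>, too little since
        \<open>(1 + 2 * u) * (1 - 2 * u) < 1\<close>.\<close>
      then have "\<bar>y1\<bar> \<le> u / 2"
        using y1[of 0] 2(1) x by (simp add: h_def)
      then have "1 - 3 / 2 * u \<le> h + l"
        using 2(1) x1 by (simp add: l_def)
      then show ?thesis
        using madd_error_ge_1[OF 2 \<open>\<bar>l\<bar> \<le> 2 * u\<close>] uu
        by (intro bound[of 2 "1 - 3 / 2 * u"]) (simp_all add: algebra_simps w)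
    next
      case 3
      have "\<bar>y0\<bar> < 1 / 2"
      proof (rule ccontr)
        assume "\<not> ?thesis"
        then obtain n :: int where n: "h = of_int n * u"
          using grid by auto
        have "\<bar>h\<bar> \<le> 1"
          using 3 y(2) by (simp add: h_def)
        then have "\<bar>real_of_int n\<bar> \<le> 2 ^ p"
          unfolding n u_eq abs_mult by (simp add: field_simps)
        then have "\<bar>n\<bar> \<le> 2 ^ p"
          by (simp flip: of_int_abs)
        then have "h \<in> F"
          unfolding n u_def by (rule of_int_power_int_in_F)
        then show False
          using False by simp
      qed
      then have "\<bar>y1\<bar> \<le> u / 4" "- (1 / 2 - u / 2) \<le> y0"
        using y1[of "- 1"] F_less_half[OF y(1)] by (simp_all add: power_int_minus)
      then have l: "\<bar>l\<bar> \<le> 5 / 4 * u"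
        unfolding l_def using x1 by linarith
      have h: "1 / 2 \<le> h"
        unfolding h_def using x(2) \<open>\<bar>y0\<bar> < 1 / 2\<close> by linarith
      \<comment> \<open>As \<open>x0 + x1\<close> rounds to \<open>x0 \<ge> 1\<close>, it is not
        nearer to \<open>1 - u\<close>, the predecessor of 1, so it is at least the midpoint
        \<open>1 - u / 2\<close>. Likewise \<open>y0 + y1\<close> is at least the midpoint of
        \<open>- (1 / 2)\<close> and its upper neighbour \<open>- (1 / 2 - u / 2)\<close>.\<close>
      have "of_int (2 ^ p - 1) * 2 powi (- int p) = 1 - u"
        unfolding u_def[symmetric] by (simp add: u_eq field_simps)
      then have "1 - u \<in> F"
        using of_int_power_int_in_F[of "2 ^ p - 1" "- int p"] by simp
      from R_nearest[OF this, of "x0 + x1"] have "1 - u / 2 \<le> x0 + x1"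
        unfolding x(4) using x(2) uu(2) by linarith
      moreover have "- (1 / 2) \<in> F"
        using power_int_in_F[of "- 1"] uminus_in_F_iff[of "1 / 2"] by (simp add: power_int_minus field_simps)
      from R_nearest[OF this, of "y0 + y1"] have "- (1 / 2 - u / 4) \<le> y0 + y1"
        unfolding y(3) using \<open>- (1 / 2 - u / 2) \<le> y0\<close> uu(2) by linarith
      ultimately have S: "1 / 2 - u / 4 \<le> h + l"
        by (simp add: h_def l_def)
      from madd_error_less_1[OF h _ l] 3
      consider "R h = 1" "\<bar>madd_error h l\<bar> \<le> 3 / 2 * u\<^sup>2" | "\<bar>madd_error h l\<bar> \<le> u\<^sup>2"
        by linarith
      then show ?thesis
      proof cases
        case 1
        have "1 - u / 2 \<le> h"
          using R_error[of h 0] h 3 1(1) by simp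
        then have "1 - 2 * u \<le> h + l"
          using l by linarith
        then show ?thesis
          using 1(2) uu by (intro bound[of "3 / 2" "1 - 2 * u"]) (simp_all add: algebra_simps w)
      next
        case 2
        then show ?thesis
          using S uu by (intro bound[of 1 "1 / 2 - u / 4"]) (simp_all add: algebra_simps w)
      qed
    qed
  qed
  then show ?thesis
    by (simp add: h_def l_def)
qed

lemma madd_error_le_of_abs_le:
  assumes x: "x0 \<in> F" "R (x0 + x1) = x0"
    and y: "y0 \<in> F" "R (y0 + y1) = y0" "\<bar>y0\<bar> \<le> \<bar>x0\<bar>"
    and d: "x1 + y1 - R (x1 + y1) \<in> F"
  shows "\<bar>madd_error (x0 + y0) (x1 + y1)\<bar> \<le> 2 * u\<^sup>2 * (1 + 2 * u) * \<bar>x0 + y0 + (x1 + y1)\<bar>"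
proof (cases "x0 = 0")
  case True
  \<comment> \<open>A number that rounds to 0 is 0, by the error bound relative to the
    result.\<close>
  then have "x1 = 0" "y0 = 0" "y1 = 0"
    using x(2) y(2,3) R_rel_error_R[of x1] R_rel_error_R[of y1] by auto
  then show ?thesis
    using True R_of_F[of 0] constants_in_F by (simp add: madd_error_def)
next
  case False
  then obtain k where k: "2 powi k \<le> \<bar>x0\<bar>" "\<bar>x0\<bar> < 2 powi (k + 1)"
    using ex_power_int_bounds[of "\<bar>x0\<bar>"] by (metis zero_less_abs_iff)
  \<comment> \<open>Multiplying by \<open>s\<close> removes the sign and the exponent of
    \<open>x0\<close>, which brings it into the range from 1 to 2.\<close>
  define s where "s = sgn x0 * 2 powi (- k)"
  have s: "scaling s"
    unfolding scaling_def using False by (intro exI[of _ "- k"]) (simp add: s_def abs_mult abs_sgn_eq)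
  have sx: "s * x0 = \<bar>x0\<bar> / 2 powi k"
    by (simp add: s_def power_int_minus divide_inverse abs_sgn mult_ac)
  have abs_s: "\<bar>s\<bar> > 0"
    using scaling_nonzero[OF s] by simp
  have "\<bar>madd_error (s * x0 + s * y0) (s * x1 + s * y1)\<bar> \<le>
    2 * u\<^sup>2 * (1 + 2 * u) * \<bar>s * x0 + s * y0 + (s * x1 + s * y1)\<bar>"
  proof (rule madd_error_normalized)
    show "1 \<le> s * x0" "s * x0 < 2"
      using k unfolding sx by (simp_all add: power_int_add field_simps)
    have "\<bar>s * y0\<bar> \<le> \<bar>s * x0\<bar>"
      unfolding abs_mult using y(3) by (intro mult_left_mono) auto
    then show "\<bar>s * y0\<bar> \<le> s * x0"
      unfolding sx by simp
    show "R (s * x0 + s * x1) = s * x0" "R (s * y0 + s * y1) = s * y0"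
      using x y by (simp_all add: R_scale[OF s] flip: distrib_left)
    have "s * x1 + s * y1 - R (s * x1 + s * y1) = s * (x1 + y1 - R (x1 + y1))"
      by (simp add: R_scale[OF s] right_diff_distrib flip: distrib_left)
    then show "s * x1 + s * y1 - R (s * x1 + s * y1) \<in> F"
      using d scaling_in_F[OF s] by simp
  qed (use x y scaling_in_F[OF s] in auto)
  then have "\<bar>s\<bar> * \<bar>madd_error (x0 + y0) (x1 + y1)\<bar> \<le>
    \<bar>s\<bar> * (2 * u\<^sup>2 * (1 + 2 * u) * \<bar>x0 + y0 + (x1 + y1)\<bar>)"
    by (simp add: madd_error_scale[OF s] abs_mult mult_ac flip: distrib_left)
  then show ?thesis
    using abs_s by simp
qed

lemma madd_error_le:
  assumes "x0 \<in> F" "R (x0 + x1) = x0" "y0 \<in> F" "R (y0 + y1) = y0"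
    and "x1 + y1 - R (x1 + y1) \<in> F"
  shows "\<bar>madd_error (x0 + y0) (x1 + y1)\<bar> \<le> 2 * u\<^sup>2 * (1 + 2 * u) * \<bar>x0 + y0 + (x1 + y1)\<bar>"
  using madd_error_le_of_abs_le[of x0 x1 y0 y1] madd_error_le_of_abs_le[of y0 y1 x0 x1] assms
  by (cases "\<bar>y0\<bar> \<le> \<bar>x0\<bar>") (simp_all add: add.commute)

end

section \<open>Transfer to the given format\<close>

theorem theorem2:
  fixes fmt :: fp_format and p :: nat and u :: real
    and x0 x1 y0 y1 a b c d a' c' b' b'' z0 z1 :: real
  assumes "p = precision fmt" and "u = 2 powi (- int p)"
    and inputs: "{x0, x1, y0, y1} \<subseteq> floats fmt"
    and "x0 = RNE fmt (x0 + x1)" and "y0 = RNE fmt (y0 + y1)"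
    and "(a, b) = TwoSum fmt x0 y0"
    and "(c, d) = TwoSum fmt x1 y1"
    and "(a', c') = TwoSum fmt a c"
    and "b' = fp_add fmt b d"
    and "b'' = fp_add fmt b' c'"
    and "(z0, z1) = TwoSum fmt a' b''"
    and no_exceptions: "{a, b, c, d, a', c', b', b'', z0, z1} \<subseteq> floats fmt"
    and "x0 + x1 + y0 + y1 \<noteq> 0"
  shows "\<bar>(z0 + z1) - (x0 + x1 + y0 + y1)\<bar> / \<bar>x0 + x1 + y0 + y1\<bar>
           \<le> (1 + 2 * u) * 2 powi (- (2 * int p - 1))"
proof -
  interpret fp: fp_rounding p
    by unfold_locales (cases fmt; simp add: assms(1))
  have R: "RNE fmt r = fp.R r" for r
    by (simp only: RNE_def fp.R_def flip: assms(1))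
  have F: "x \<in> fp.F" if "x \<in> floats fmt" for x
    using that floats_subset assms(1) by blast
  have u: "fp.u = u"
    by (simp add: fp.u_def assms(2))
  have ops: "a = fp.R (x0 + y0)" "b = x0 + y0 - a" "c = fp.R (x1 + y1)" "d = x1 + y1 - c"
    "a' = fp.R (a + c)" "c' = a + c - a'" "b'' = fp.R (fp.R (b + d) + c')" "z0 + z1 = a' + b''"
    using assms(6-11) by (simp_all add: TwoSum_def fp_add_def R)
  \<comment> \<open>The assumption \<open>no_exceptions\<close> makes \<open>d\<close>
    representable, which is the last premise of the estimate.\<close>
  have "\<bar>fp.madd_error (x0 + y0) (x1 + y1)\<bar> \<le>
      2 * u\<^sup>2 * (1 + 2 * u) * \<bar>x0 + y0 + (x1 + y1)\<bar>"
    unfolding u[symmetric]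
    using inputs no_exceptions assms(4,5) F by (intro fp.madd_error_le) (simp_all add: R flip: ops)
  \<comment> \<open>By the exactness of the TwoSum steps the exact sum is
    \<open>a' + (b + d + c')\<close>, while \<open>z0 + z1 = a' + b''\<close>.\<close>
  moreover have "fp.madd_error (x0 + y0) (x1 + y1) = z0 + z1 - (x0 + x1 + y0 + y1)"
  proof -
    have "fp.madd_error (x0 + y0) (x1 + y1) = b'' - (b + d + c')"
      by (simp add: fp.madd_error_def Let_def flip: ops)
    then show ?thesis
      using ops(2,4,6,8) by simp
  qed
  moreover have "2 * u\<^sup>2 = 2 powi (- (2 * int p - 1))"
  proof -
    have "- (2 * int p - 1) = 1 + - int p + - int p"
      by simp
    then show ?thesis
      unfolding assms(2) power2_eq_square
      by (metis (no_types) mult.assoc power_int_1_right power_int_add zero_neq_numeral)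
  qed
  ultimately show ?thesis
    using assms(13) by (simp add: divide_le_eq add_ac mult_ac)
qed

end
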